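(* Let $n\in\mathbb{N}$, $n\ge1$, and let $w\in C^2((0,\infty))$ be a real-valued function such that $w'(1)=0$ and $w''(1)>0$. Then the function $$W_{\mathrm{VL}}\colon\mathrm{GL}^+(n)\to\mathbb{R},\qquad W_{\mathrm{VL}}(F) = \sum_{i=1}^n w(\lambda_i),$$ where $\lambda_1,\dots,\lambda_n$ are the singular values of $F$, has a polyconvex extension from a neighborhood of the identity $F=\mathrm{id}$ to $\mathrm{GL}^+(n)$; that is, there exist a neighborhood $\mathcal{U}\subset\mathrm{GL}^+(n)$ of the identity matrix $\mathrm{id}$ and a polyconvex function $\widetilde{W}_{\mathrm{VL}}\colon\mathrm{GL}^+(n)\to\mathbb{R}$ such that $\widetilde{W}_{\mathrm{VL}}(F)=W_{\mathrm{VL}}(F)$ for all $F\in\mathcal{U}$.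
   Context: $\mathrm{GL}^+(n)$ is the set of real $n\times n$ matrices with positive determinant. A function $W\colon\mathrm{GL}^+(n)\to\mathbb{R}$ is called polyconvex if there is a convex function $P$ such that $W(F)=P(M(F))$ for all $F\in\mathrm{GL}^+(n)$, where $M(F)$ is the vector of all minors of $F$ of all orders $1,\dots,n$ and $P$ is defined on the convex set of all vectors of that size whose entry corresponding to $\det F$ is positive. *)

theory Defs
  imports "HOL-Analysis.Analysis" "HOL-Computational_Algebra.Polynomial"
begin

definition GL_plus :: "(real^'n^'n) set" where
  "GL_plus = {F. 0 < det F}"


section \<open>Singular values\<close>

definition charpoly :: "real^'n^'n \<Rightarrow> real poly" where
  "charpoly A = det (mat [:0, 1:] - map_matrix (\<lambda>a. [:a:]) A)"

(* Counted with multiplicity. Since F^T F is symmetric positive semidefinite, all roots of its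
   characteristic polynomial are real and nonnegative, so the multiset has CARD('n) elements. *)
definition singular_values :: "real^'n^'n \<Rightarrow> real multiset" where
  "singular_values F = image_mset sqrt (proots (charpoly (transpose F ** F)))"

definition W_VL :: "(real \<Rightarrow> real) \<Rightarrow> real^'n^'n \<Rightarrow> real" where
  "W_VL w F = (\<Sum>s\<in>#singular_values F. w s)"


section \<open>Minors and polyconvexity\<close>

(* A linear order on the index type plays the role of the order on {1, ..., n}: the rows and
   columns of a submatrix are listed increasingly, which fixes the sign of each minor. This is
   the Leibniz formula for the submatrix with rows I and columns J, meant for card I = card J. *)
definition minor :: "real^'n::{finite,linorder}^'n::{finite,linorder} \<Rightarrow> 'n set \<Rightarrow> 'n set \<Rightarrow> real" where
  "minor F I J =
     (\<Sum>p | p permutes {..<card I}.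
        of_int (sign p) *
        (\<Prod>k<card I. F $ (sorted_list_of_set I ! k) $ (sorted_list_of_set J ! p k)))"

lemma minor_UNIV: "minor F UNIV UNIV = det (F :: real^'n::{finite,linorder}^'n::{finite,linorder})"
proof -
  let ?n = "CARD('n)" and ?e = "\<lambda>k. sorted_list_of_set (UNIV :: 'n set) ! k"
  let ?A = "{..<CARD('n)}" 
  have e: "bij_betw ?e ?A UNIV"
    by (rule bij_betw_nth) auto
  have eb: "bij_betw (map_permutation ?A ?e) {p. p permutes ?A} {p. p permutes (UNIV::'n set)}"
  proof -
    have 1: "bij_betw (\<lambda>\<pi> x. if x \<in> UNIV then ?e (\<pi> (inv_into ?A ?e x)) else x)
                 {p. p permutes ?A} {p. p permutes (UNIV::'n set)}"
      by (rule bij_betw_permutations[OF e])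
    have im: "?e ` ?A = UNIV" using e by (simp add: bij_betw_def)
    have "map_permutation ?A ?e p = (\<lambda>x. if x \<in> UNIV then ?e (p (inv_into ?A ?e x)) else x)" for p
      unfolding map_permutation_def im by (simp add: restrict_id_def fun_eq_iff)
    then show ?thesis using 1 by presburger
  qed
  show ?thesis
    unfolding minor_def det_def
  proof (subst sum.reindex_bij_betw[OF eb, symmetric], rule sum.cong[OF refl])
    fix p assume "p \<in> {p. p permutes ?A}"
    then have p: "p permutes ?A" by simp
    have "(\<Prod>i\<in>UNIV. F $ i $ map_permutation ?A ?e p i) = (\<Prod>k<?n. F $ ?e k $ ?e (p k))"
      using e by (subst prod.reindex_bij_betw[OF e, symmetric], intro prod.cong refl,
          subst map_permutation_apply) (auto simp: bij_betw_def)
    moreover have "sign (map_permutation ?A ?e p) = sign p"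
      by (rule sign_map_permutation) (use e p in \<open>auto simp: bij_betw_def\<close>)
    ultimately show "of_int (sign p) * (\<Prod>k<card (UNIV::'n set). F $ ?e k $ ?e (p k)) =
       of_int (sign (map_permutation ?A ?e p)) * (\<Prod>i\<in>UNIV. F $ i $ map_permutation ?A ?e p i)"
      by simp
  qed
qed

typedef 'n minor_index = "{(I :: 'n::finite set, J :: 'n set). I \<noteq> {} \<and> card I = card J}"
  by (rule exI[of _ "(UNIV, UNIV)"]) simp

instance minor_index :: (finite) finite
proof
  have "inj (Rep_minor_index :: 'a minor_index \<Rightarrow> _)"
    by (simp add: inj_on_def Rep_minor_index_inject)
  then show "finite (UNIV :: 'a minor_index set)"
    by (rule finite_imageD[rotated]) simp
qed

definition full_index :: "'n::finite minor_index" where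
  "full_index = Abs_minor_index (UNIV, UNIV)"

definition minors :: "real^'n::{finite,linorder}^'n::{finite,linorder} \<Rightarrow> real^('n minor_index)" where
  "minors F = (\<chi> m. case Rep_minor_index m of (I, J) \<Rightarrow> minor F I J)"

lemma minors_full_index: "minors F $ full_index = det F"
  by (simp add: minors_def full_index_def Abs_minor_index_inverse minor_UNIV)

definition polyconvex :: "(real^'n::{finite,linorder}^'n::{finite,linorder} \<Rightarrow> real) \<Rightarrow> bool" where
  "polyconvex W \<longleftrightarrow>
     (\<exists>P. convex_on {v :: real^('n minor_index). 0 < v $ full_index} P \<and>
          (\<forall>F\<in>GL_plus. W F = P (minors F)))"

end

theory Submission
  imports Defs
begin

text \<open>At the identity the second derivative of \<open>W_VL w\<close> is \<open>w'' 1 * |sym H|\<^sup>2\<close>, which degenerates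
  exactly on skew matrices \<open>H\<close>. The second elementary symmetric polynomial
  \<open>N F = ((tr F)\<^sup>2 - tr (F\<^sup>2)) / 2\<close> is a linear combination of minors of order 2, and
  \<open>2 * N H = (tr H)\<^sup>2 - |sym H|\<^sup>2 + |skew H|\<^sup>2\<close> is positive on those directions. Hence
  \<open>G = W_VL w + \<epsilon> * N\<close> is convex near the identity for small \<open>\<epsilon> > 0\<close>, and the supremum of its affine
  minorants, minus \<open>\<epsilon>\<close> times the linear combination of minors, extends \<open>W_VL w\<close>.

  To obtain the affine minorants without differentiating singular values, split
  \<open>w x = g x + b/2 * x\<^sup>2 - c * x\<close> with \<open>g\<close> convex and increasing near 1. The sum of \<open>g\<close> over the singular
  values is handled by doubly stochastic averaging and the quadratic term is \<open>b/2 * |F|\<^sup>2\<close>; the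
  concave term, a multiple of the nuclear norm, is bounded by its linearization plus half the
  square of the skew part of \<open>R\<^sup>T F\<close>, where \<open>R\<close> is the rotation in the polar decomposition of the
  base point.\<close>

subsection \<open>Singular value decomposition\<close>

lemma matrix_sub_ldistrib: "A ** (B - C) = A ** B - A ** (C :: 'a::ring_1^'p^'n)"
  by (simp add: vec_eq_iff matrix_matrix_mult_def right_diff_distrib sum_subtractf)

lemma matrix_sub_rdistrib: "(A - B) ** C = A ** C - B ** (C :: 'a::ring_1^'p^'n)"
  by (simp add: vec_eq_iff matrix_matrix_mult_def left_diff_distrib sum_subtractf)

text \<open>Maximize the Rayleigh quotient over the unit sphere of \<open>S\<close>. At a maximizer
  \<open>u\<close> the residual \<open>z = f u - c u\<close> lies in \<open>S\<close> and is
  orthogonal to \<open>u\<close>. Moving from \<open>u\<close> along a nonzero \<open>z\<close>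
  would raise the quotient to first order, so \<open>z = 0\<close>.\<close>

lemma self_adjoint_max_eigenvector:
  fixes f :: "'a::euclidean_space \<Rightarrow> 'a"
  assumes "linear f" and self_adjoint: "\<And>x y. f x \<bullet> y = x \<bullet> f y"
    and S: "subspace S" "f ` S \<subseteq> S" "S \<noteq> {0}"
  obtains u c where "u \<in> S" "norm u = 1" "f u = c *\<^sub>R u"
proof -
  interpret linear f by fact
  let ?K = "S \<inter> sphere 0 1"
  have "compact ?K"
    using S by (simp add: closed_Int_compact closed_subspace)
  moreover have "?K \<noteq> {}"
  proof -
    obtain x where "x \<in> S" "x \<noteq> 0"
      using S subspace_0 by blast
    then have "x /\<^sub>R norm x \<in> ?K"
      using S by (simp add: subspace_scale)
    then show ?thesis by blast
  qed
  moreover have "continuous_on ?K (\<lambda>x. x \<bullet> f x)"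
    by (intro continuous_intros linear_continuous_on) (simp add: linear_linear linear_axioms)
  ultimately obtain u where u: "u \<in> ?K" and max: "\<And>x. x \<in> ?K \<Longrightarrow> x \<bullet> f x \<le> u \<bullet> f u"
    using continuous_attains_sup[of ?K "\<lambda>x. x \<bullet> f x"] by blast
  define c where "c = u \<bullet> f u"
  define z where "z = f u - c *\<^sub>R u"
  have uS: "u \<in> S" and nu: "norm u = 1"
    using u by auto
  have uu: "u \<bullet> u = 1"
    using nu by (simp add: dot_square_norm)
  have zS: "z \<in> S"
    using S uS by (auto simp: z_def intro!: subspace_diff subspace_scale)
  have uz: "u \<bullet> z = 0"
    by (simp add: z_def inner_diff_right c_def uu)
  have zfu: "z \<bullet> f u = z \<bullet> z"
    using uz by (simp add: z_def inner_diff_right inner_commute algebra_simps)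
  have bound: "x \<bullet> f x \<le> c * (x \<bullet> x)" if "x \<in> S" for x
  proof (cases "x = 0")
    case True
    then show ?thesis by (simp add: zero)
  next
    case False
    then have "x /\<^sub>R norm x \<in> ?K"
      using S that by (simp add: subspace_scale)
    from max[OF this] have "(x \<bullet> f x) / (norm x)\<^sup>2 \<le> c"
      by (simp add: scale c_def power2_eq_square divide_simps)
    then show ?thesis
      using False by (simp add: field_simps dot_square_norm)
  qed
  have quad: "2 * t * (z \<bullet> z) \<le> t\<^sup>2 * (c * (z \<bullet> z) - z \<bullet> f z)" for t
  proof -
    have "u + t *\<^sub>R z \<in> S"
      using S uS zS by (simp add: subspace_add subspace_scale)
    from bound[OF this] have "c + 2 * t * (z \<bullet> z) + t\<^sup>2 * (z \<bullet> f z) \<le> c * (1 + t\<^sup>2 * (z \<bullet> z))"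
      using uz zfu uu self_adjoint[of u z]
      by (simp add: add scale algebra_simps power2_eq_square inner_commute flip: c_def)
    then show ?thesis by (simp add: algebra_simps)
  qed
  have "z \<bullet> z \<le> 0"
  proof (rule ccontr)
    assume "\<not> z \<bullet> z \<le> 0"
    then have pos: "0 < z \<bullet> z" by linarith
    \<comment> \<open>\<open>M\<close> dominates the quadratic coefficient, so with this
      \<open>t\<close> the quadratic term is at most \<open>t * (z \<bullet> z)\<close>, half of the
      linear one. The \<open>+ 1\<close> keeps \<open>M\<close> positive.\<close>
    define M where "M = \<bar>c * (z \<bullet> z) - z \<bullet> f z\<bar> + 1"
    define t where "t = (z \<bullet> z) / M"
    have M: "M > 0" and t: "t > 0" using pos by (auto simp: M_def t_def)
    have "2 * t * (z \<bullet> z) \<le> t\<^sup>2 * M"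
      by (rule order_trans[OF quad], rule mult_left_mono) (auto simp: M_def)
    also have "\<dots> = t * (z \<bullet> z)"
      using M by (simp add: t_def power2_eq_square)
    finally show False using pos t by (simp add: mult_pos_pos)
  qed
  then have "z = 0"
    using inner_ge_zero[of z] by (simp add: antisym)
  then have "f u = c *\<^sub>R u" by (simp add: z_def)
  then show ?thesis using that uS nu by blast
qed

text \<open>Split off one eigenvector at a time: by self-adjointness its orthogonal complement in
  \<open>S\<close> is again invariant, so induction on the dimension applies.\<close>

lemma self_adjoint_orthonormal_eigenbasis:
  fixes f :: "'a::euclidean_space \<Rightarrow> 'a"
  assumes lin: "linear f" and self_adjoint: "\<And>x y. f x \<bullet> y = x \<bullet> f y"
    and "subspace S" "f ` S \<subseteq> S"
  shows "\<exists>B\<subseteq>S. finite B \<and> card B = dim S \<and> pairwise orthogonal B \<and>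
           (\<forall>b\<in>B. norm b = 1 \<and> (\<exists>c. f b = c *\<^sub>R b))"
  using assms(3-)
proof (induction "dim S" arbitrary: S)
  case 0
  then show ?case by (intro exI[of _ "{}"]) auto
next
  case (Suc n)
  then have "S \<noteq> {0}" by auto
  then obtain u c where u: "u \<in> S" "norm u = 1" "f u = c *\<^sub>R u"
    using self_adjoint_max_eigenvector[OF lin self_adjoint] Suc.prems by metis
  define T where "T = {y \<in> S. \<forall>x\<in>span {u}. orthogonal x y}"
  have T: "T = {y \<in> S. u \<bullet> y = 0}"
    by (auto simp: T_def span_singleton orthogonal_def)
  have "dim T + dim (span {u}) = dim S"
    unfolding T_def using u Suc.prems
    by (intro dim_subspace_orthogonal_to_vectors) (auto simp: span_minimal)
  moreover have "dim (span {u}) = 1"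
    using u by (subst dim_span, subst dim_singleton) auto
  ultimately have dimT: "dim T = n" using Suc.hyps by simp
  have subT: "subspace T"
    using Suc.prems(1) by (auto simp: T subspace_def inner_right_distrib)
  have fT: "f ` T \<subseteq> T"
  proof
    fix y assume "y \<in> f ` T"
    then obtain x where x: "x \<in> S" "u \<bullet> x = 0" "y = f x" by (auto simp: T)
    then have "u \<bullet> f x = 0"
      using self_adjoint[of u x] u by simp
    then show "y \<in> T" using x Suc.prems by (auto simp: T)
  qed
  obtain B where B: "B \<subseteq> T" "finite B" "card B = n" "pairwise orthogonal B"
      "\<forall>b\<in>B. norm b = 1 \<and> (\<exists>c. f b = c *\<^sub>R b)"
    using Suc.hyps(1)[OF dimT[symmetric] subT fT] dimT by auto
  have "u \<notin> B"
    using B(1) u by (auto simp: T)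
  then have "card (insert u B) = dim S"
    using B Suc.hyps by simp
  moreover have "pairwise orthogonal (insert u B)"
    using B by (auto simp: pairwise_insert T orthogonal_def inner_commute)
  ultimately show ?case
    using B u by (intro exI[of _ "insert u B"]) (auto simp: T)
qed

definition diag :: "('n \<Rightarrow> 'a::zero) \<Rightarrow> 'a^'n^'n" where
  "diag d = (\<chi> i j. if i = j then d i else 0)"

lemma diag_nth: "diag d $ i $ j = (if i = j then d i else 0)"
  by (simp add: diag_def)

lemma transpose_diag [simp]: "transpose (diag d) = diag d"
  by (auto simp: transpose_def diag_def vec_eq_iff)

lemma mult_diag_nth: "(A ** diag d) $ i $ j = A $ i $ j * (d j :: 'a::semiring_1)"
  by (simp add: matrix_matrix_mult_def diag_def if_distrib cong: if_cong)

lemma diag_mult_diag: "diag d ** diag e = diag (\<lambda>i. d i * e i :: 'a::semiring_1)"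
  by (simp add: vec_eq_iff mult_diag_nth) (simp add: diag_nth)

lemma symmetric_matrix_diagonalization:
  fixes A :: "real^'n^'n"
  assumes "transpose A = A"
  obtains Q d where "orthogonal_matrix Q" "A = Q ** diag d ** transpose Q"
proof -
  have self_adjoint: "(A *v x) \<bullet> y = x \<bullet> (A *v y)" for x y
    using dot_lmul_matrix[of x A y] assms
    by (metis dot_lmul_matrix inner_commute vector_transpose_matrix)
  obtain B where B: "finite B" "card B = CARD('n)" "pairwise orthogonal B"
      "\<And>b. b \<in> B \<Longrightarrow> norm b = 1" "\<And>b. b \<in> B \<Longrightarrow> \<exists>c. A *v b = c *\<^sub>R b"
    using self_adjoint_orthonormal_eigenbasis[of "(*v) A" UNIV] self_adjoint by auto
  obtain h where h: "bij_betw h (UNIV :: 'n set) B"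
    using B by (metis finite_same_card_bij finite_class.finite_UNIV)
  then have hB: "h i \<in> B" for i by (auto simp: bij_betw_def)
  obtain d where d: "\<And>i. A *v h i = d i *\<^sub>R h i"
    using B(5)[OF hB] by metis
  define Q :: "real^'n^'n" where "Q = (\<chi> i j. h j $ i)"
  have h_inner: "h i \<bullet> h j = (if i = j then 1 else 0)" for i j
  proof (cases "i = j")
    case True
    then show ?thesis using B(4)[OF hB] by (simp add: dot_square_norm)
  next
    case False
    then have "h i \<noteq> h j" using h by (auto simp: bij_betw_def inj_on_def)
    then show ?thesis using B(3) hB False by (auto simp: pairwise_def orthogonal_def)
  qed
  have "transpose Q ** Q = mat 1"
    using h_inner by (simp add: vec_eq_iff matrix_matrix_mult_def transpose_def Q_def mat_def
        inner_vec_def)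
  then have Q: "orthogonal_matrix Q" by (simp add: orthogonal_matrix)
  have "A ** Q = Q ** diag d"
  proof -
    have "(A ** Q) $ i $ j = (A *v h j) $ i" for i j
      by (simp add: matrix_matrix_mult_def matrix_vector_mult_def Q_def)
    then show ?thesis
      by (simp add: vec_eq_iff mult_diag_nth d Q_def mult.commute)
  qed
  then have "A = Q ** diag d ** transpose Q"
    using Q by (metis matrix_mul_assoc matrix_mul_rid orthogonal_matrix_def)
  then show ?thesis using that Q by blast
qed

definition is_svd :: "real^'n^'n \<Rightarrow> real^'n^'n \<Rightarrow> ('n \<Rightarrow> real) \<Rightarrow> real^'n^'n \<Rightarrow> bool" where
  "is_svd F X d Y \<longleftrightarrow> orthogonal_matrix X \<and> orthogonal_matrix Y \<and> (\<forall>i. 0 \<le> d i) \<and>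
     F = X ** diag d ** transpose Y"

text \<open>Diagonalize \<open>transpose F ** F\<close> by \<open>Y\<close>. The columns of
  \<open>F ** Y\<close> are then orthogonal, with the eigenvalues as squared lengths; these are
  positive because \<open>F\<close> is invertible, and normalizing the columns gives
  \<open>X\<close>.\<close>

lemma svd_exists:
  fixes F :: "real^'n^'n"
  assumes "det F \<noteq> 0"
  obtains X d Y where "is_svd F X d Y"
proof -
  have "transpose (transpose F ** F) = transpose F ** F"
    by (simp add: matrix_transpose_mul)
  then obtain Y e where Y: "orthogonal_matrix Y"
      and e: "transpose F ** F = Y ** diag e ** transpose Y"
    using symmetric_matrix_diagonalization by blast
  have YtY: "transpose Y ** Y = mat 1" and YYt: "Y ** transpose Y = mat 1"
    using Y by (auto simp: orthogonal_matrix_def)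
  define G where "G = F ** Y"
  have G: "transpose G ** G = diag e"
    unfolding G_def matrix_transpose_mul
    by (metis (no_types) e YtY matrix_mul_assoc matrix_mul_lid matrix_mul_rid)
  have e_pos: "0 < e k" for k
  proof -
    have nz: "det G \<noteq> 0"
      using assms YtY unfolding G_def det_mul
      by (metis det_I det_mul mult_zero_right zero_neq_one mult_eq_0_iff)
    have "e k = column k G \<bullet> column k G"
      using arg_cong[OF G, of "\<lambda>A. A $ k $ k"]
      by (simp add: matrix_matrix_mult_def transpose_def diag_nth column_def inner_vec_def)
    moreover have "column k G \<noteq> 0"
      using nz det_zero_column(1)[of k G] by blast
    ultimately show ?thesis by simp
  qed
  define d where "d = (\<lambda>k. sqrt (e k))"
  define X where "X = G ** diag (\<lambda>k. inverse (d k))"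
  have d_pos: "0 < d k" for k using e_pos by (simp add: d_def)
  then have d_nz: "d k \<noteq> 0" for k by (metis less_irrefl)
  have ed: "e k = d k * d k" for k
    using e_pos[of k] by (simp add: d_def)
  have "transpose X ** X = diag (\<lambda>k. inverse (d k)) ** diag e ** diag (\<lambda>k. inverse (d k))"
    unfolding X_def matrix_transpose_mul transpose_diag
    by (metis G matrix_mul_assoc)
  also have "\<dots> = mat 1"
    using d_nz by (simp add: diag_mult_diag ed mat_def vec_eq_iff diag_nth field_simps)
  finally have X: "orthogonal_matrix X" by (simp add: orthogonal_matrix)
  have "X ** diag d = G"
    unfolding X_def using d_nz by (simp add: vec_eq_iff mult_diag_nth)
  then have "F = X ** diag d ** transpose Y"
    using YYt by (metis G_def matrix_mul_assoc matrix_mul_rid)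
  then have "is_svd F X d Y"
    using X Y d_pos by (simp add: is_svd_def less_imp_le)
  then show ?thesis by (rule that)
qed

text \<open>Lifted entrywise to constant polynomials, \<open>Q\<close> keeps its transpose as
  inverse, and the scalar matrix \<open>mat [:0, 1:]\<close> commutes with it. Hence the
  characteristic matrix is conjugate to a diagonal one.\<close>

lemma charpoly_diagonalized:
  fixes Q :: "real^'n^'n"
  assumes "orthogonal_matrix Q"
  shows "charpoly (Q ** diag e ** transpose Q) = (\<Prod>i\<in>UNIV. [:- e i, 1:])"
proof -
  let ?C = "map_matrix (\<lambda>a::real. [:a:])"
  have C_mult: "?C (A ** B) = ?C A ** ?C B" for A B :: "real^'n^'n"
    by (simp add: vec_eq_iff matrix_matrix_mult_def sum_to_poly mult.commute)
  have C_1: "?C (mat 1) = mat 1"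
    by (simp add: vec_eq_iff mat_def map_matrix_def one_pCons)
  have unit: "?C Q ** ?C (transpose Q) = mat 1"
    using assms by (simp flip: C_mult add: orthogonal_matrix_def C_1)
  have X: "mat [:0, 1:] = ?C Q ** mat [:0, 1:] ** ?C (transpose Q)"
  proof -
    have "A ** mat x = mat x ** A" for A :: "real poly^'n^'n" and x
      by (simp add: vec_eq_iff matrix_matrix_mult_def mat_def if_distrib if_distribR mult.commute
          cong: if_cong)
    then show ?thesis by (metis unit matrix_mul_assoc matrix_mul_rid)
  qed
  have "charpoly (Q ** diag e ** transpose Q) =
      det (?C Q ** (mat [:0, 1:] - ?C (diag e)) ** ?C (transpose Q))"
    unfolding charpoly_def C_mult
    by (subst X) (simp add: matrix_sub_ldistrib matrix_sub_rdistrib)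
  also have "\<dots> = det (?C Q ** ?C (transpose Q)) * det (mat [:0, 1:] - ?C (diag e))"
    by (simp add: det_mul)
  also have "det (mat [:0, 1:] - ?C (diag e)) = (\<Prod>i\<in>UNIV. [:- e i, 1:])"
    by (subst det_diagonal) (auto simp: diag_nth mat_def)
  also have "det (?C Q ** ?C (transpose Q)) = 1"
    unfolding unit by simp
  finally show ?thesis by simp
qed

text \<open>Since \<open>transpose F ** F\<close> is diagonalized by \<open>Y\<close> with entries
  \<open>d i * d i\<close>, these are the roots of its characteristic polynomial with multiplicity.
  So any decomposition, in any order, may be used to evaluate \<open>W_VL\<close>.\<close>

lemma W_VL_svd:
  fixes F :: "real^'n^'n"
  assumes "is_svd F X d Y"
  shows "W_VL w F = (\<Sum>i\<in>UNIV. w (d i))"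
proof -
  have X: "transpose X ** X = mat 1" and Y: "orthogonal_matrix Y" and d: "\<And>i. 0 \<le> d i"
    and F: "F = X ** diag d ** transpose Y"
    using assms by (auto simp: is_svd_def orthogonal_matrix)
  have "transpose F ** F = Y ** diag d ** (transpose X ** X) ** diag d ** transpose Y"
    unfolding F matrix_transpose_mul by (simp add: matrix_mul_assoc)
  also have "\<dots> = Y ** diag (\<lambda>i. d i * d i) ** transpose Y"
    unfolding X by (simp add: diag_mult_diag flip: matrix_mul_assoc)
  finally have "proots (charpoly (transpose F ** F)) = (\<Sum>i\<in>UNIV. {#d i * d i#})"
    using charpoly_diagonalized[OF Y] by (simp add: proots_prod)
  also have "\<dots> = image_mset (\<lambda>i. d i * d i) (mset_set UNIV)"
    by (simp add: sum_unfold_sum_mset)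
  finally have "singular_values F = image_mset d (mset_set UNIV)"
    using d by (simp add: singular_values_def image_mset.compositionality o_def)
  then show ?thesis
    by (simp add: W_VL_def image_mset.compositionality o_def sum_unfold_sum_mset)
qed

subsection \<open>Frobenius inner product\<close>

lemma inner_matrix_trace: "(A :: real^'n^'m) \<bullet> B = trace (transpose A ** B)"
  unfolding trace_def inner_vec_def matrix_matrix_mult_def transpose_def
  by (simp add: sum.swap[of _ "UNIV :: 'n set"])

lemma inner_mat_1: "mat 1 \<bullet> (A :: real^'n^'n) = trace A"
  by (simp add: inner_matrix_trace)

lemma inner_transpose: "transpose A \<bullet> B = A \<bullet> transpose (B :: real^'n^'m)"
  unfolding inner_vec_def transpose_def by (simp add: sum.swap[of _ "UNIV :: 'n set"])

lemma norm_transpose: "norm (transpose A :: real^'n^'m) = norm A"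
  by (simp add: norm_eq_sqrt_inner inner_transpose)

lemma inner_mult_left: "(A ** B) \<bullet> C = B \<bullet> (transpose A ** C)"
  for A :: "real^'n^'m" and B :: "real^'p^'n"
  by (simp add: inner_matrix_trace matrix_transpose_mul matrix_mul_assoc)

lemma inner_mult_right: "(A ** B) \<bullet> C = A \<bullet> (C ** transpose B)"
  for A :: "real^'n^'m" and B :: "real^'p^'n"
proof -
  have "(A ** B) \<bullet> C = trace (transpose B ** (transpose A ** C))"
    by (simp add: inner_matrix_trace matrix_transpose_mul matrix_mul_assoc)
  also have "\<dots> = A \<bullet> (C ** transpose B)"
    by (subst trace_mul_sym) (simp add: inner_matrix_trace matrix_mul_assoc)
  finally show ?thesis .
qed

lemma inner_orthogonal_mult:
  fixes R :: "real^'n^'n"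
  assumes "orthogonal_matrix R"
  shows "(R ** A) \<bullet> (R ** B) = A \<bullet> B" "(A ** R) \<bullet> (B ** R) = A \<bullet> B"
proof -
  show "(R ** A) \<bullet> (R ** B) = A \<bullet> B"
    using assms by (simp add: inner_mult_left matrix_mul_assoc orthogonal_matrix_def)
  show "(A ** R) \<bullet> (B ** R) = A \<bullet> B"
    using assms by (simp add: inner_mult_right[of A R] orthogonal_matrix_def flip: matrix_mul_assoc)
qed

lemma norm_orthogonal_mult:
  fixes R :: "real^'n^'n"
  assumes "orthogonal_matrix R"
  shows "norm (R ** A) = norm A" "norm (A ** R) = norm A"
  using assms by (simp_all add: norm_eq_sqrt_inner inner_orthogonal_mult)

lemma norm_orthogonal_matrix:
  "orthogonal_matrix (R :: real^'n^'n) \<Longrightarrow> norm R = norm (mat 1 :: real^'n^'n)"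
  using norm_orthogonal_mult(1)[of R "mat 1"] by simp

text \<open>Each entry of the product pairs a row of \<open>A\<close> with a column of
  \<open>B\<close>; Cauchy-Schwarz entry by entry, summed over the squares, gives
  submultiplicativity of the Frobenius norm.\<close>

lemma norm_matrix_mult_le:
  fixes A :: "real^'n^'m" and B :: "real^'p^'n"
  shows "norm (A ** B) \<le> norm A * norm B"
proof -
  have sq: "(norm C)\<^sup>2 = (\<Sum>i\<in>UNIV. (norm (C $ i))\<^sup>2)" for C :: "real^'q^'r"
    by (simp add: power2_norm_eq_inner inner_vec_def)
  have "(norm (A ** B))\<^sup>2 = (\<Sum>i\<in>UNIV. \<Sum>j\<in>UNIV. (A $ i \<bullet> transpose B $ j)\<^sup>2)"
    unfolding power2_norm_eq_inner
    by (simp add: inner_vec_def matrix_matrix_mult_def transpose_def power2_eq_square)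
  also have "\<dots> \<le> (\<Sum>i\<in>UNIV. \<Sum>j\<in>UNIV. (norm (A $ i))\<^sup>2 * (norm (transpose B $ j))\<^sup>2)"
    by (intro sum_mono) (metis Cauchy_Schwarz_ineq2 abs_le_square_iff abs_norm_cancel abs_mult
        power_mult_distrib)
  also have "\<dots> = (norm A * norm (transpose B))\<^sup>2"
    unfolding power_mult_distrib sq sum_product ..
  finally show ?thesis
    by (simp add: norm_transpose abs_le_square_iff[symmetric])
qed

lemma abs_nth_le_norm: "\<bar>(A :: real^'n^'m) $ i $ j\<bar> \<le> norm A"
  using component_le_norm_cart[of "A $ i" j] Finite_Cartesian_Product.norm_nth_le[of A i] by linarith

section \<open>Symmetric and skew parts of a matrix\<close>

definition skew :: "real^'n^'n \<Rightarrow> real^'n^'n" where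
  "skew A = (1/2) *\<^sub>R (A - transpose A)"

lemma transpose_add: "transpose (A + B) = transpose A + transpose (B :: real^'n^'m)"
  and transpose_diff: "transpose (A - B) = transpose A - transpose (B :: real^'n^'m)"
  by (simp_all add: transpose_def vec_eq_iff)

lemma skew_diff: "skew (A - B) = skew A - skew B"
  by (simp add: skew_def transpose_diff algebra_simps)

lemma skew_symmetric: "transpose A = A \<Longrightarrow> skew A = 0"
  by (simp add: skew_def)

lemma norm_skew_le: "norm (skew A) \<le> norm A"
  using norm_triangle_ineq4[of A "transpose A"] by (simp add: skew_def norm_transpose)

lemma symmetric_part:
  shows "A - skew A = (1/2) *\<^sub>R (A + transpose A)"
    and "transpose (A - skew A) = A - skew A"
    and "(A - skew A) \<bullet> skew A = 0"
proof -
  show 1: "A - skew A = (1/2) *\<^sub>R (A + transpose A)"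
    by (simp add: skew_def vec_eq_iff field_simps)
  show "transpose (A - skew A) = A - skew A"
    unfolding 1 by (simp add: transpose_scalar transpose_add add.commute)
  show "(A - skew A) \<bullet> skew A = 0"
    unfolding 1 by (simp add: skew_def inner_add_left inner_diff_right inner_transpose)
qed

text \<open>The two parts are orthogonal and transposition negates only the skew one. The second
  identity computes \<open>trace (A ** A)\<close>, the sign-changing term of the null
  Lagrangian.\<close>

lemma norm_sq_skew: "(norm A)\<^sup>2 = (norm (A - skew A))\<^sup>2 + (norm (skew A))\<^sup>2"
  and transpose_inner_skew: "transpose A \<bullet> A = (norm (A - skew A))\<^sup>2 - (norm (skew A))\<^sup>2"
proof -
  define S where "S = A - skew A"
  have S: "transpose S = S" "S \<bullet> skew A = 0"
    unfolding S_def by (rule symmetric_part)+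
  have S': "skew A \<bullet> S = 0"
    using S by (simp add: inner_commute)
  have A: "A = S + skew A"
    by (simp add: S_def)
  have K: "transpose (skew A) = - skew A"
    by (simp add: skew_def transpose_scalar transpose_diff flip: scaleR_minus_right)
  have "(norm (S + skew A))\<^sup>2 = (norm S)\<^sup>2 + (norm (skew A))\<^sup>2"
    using S by (simp add: power2_norm_eq_inner inner_add_left inner_add_right inner_commute)
  then show "(norm A)\<^sup>2 = (norm (A - skew A))\<^sup>2 + (norm (skew A))\<^sup>2"
    using A by (simp add: S_def)
  have "transpose (S + skew A) \<bullet> (S + skew A) = (norm S)\<^sup>2 - (norm (skew A))\<^sup>2"
    using S S' K
    by (simp add: transpose_add power2_norm_eq_inner inner_add_right inner_diff_left)
  then show "transpose A \<bullet> A = (norm (A - skew A))\<^sup>2 - (norm (skew A))\<^sup>2"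
    using A by (simp add: S_def)
qed

text \<open>Put \<open>M = mat 1 - R\<close>, so that
  \<open>M ** transpose M = M + transpose M\<close>. Against the symmetric part of \<open>B\<close>,
  which is close to the identity, moving from \<open>mat 1\<close> to \<open>R\<close> therefore
  loses at least \<open>(1 - \<eta>)/2\<close> times the square of \<open>norm M\<close>. The skew
  part can gain only linearly in \<open>norm M\<close>.\<close>

lemma inner_orthogonal_le_trace:
  fixes B :: "real^'n^'n"
  assumes R: "orthogonal_matrix R" and near: "norm (B - mat 1) \<le> \<eta>" "\<eta> < 1"
  shows "R \<bullet> B \<le> trace B + (norm (skew B))\<^sup>2 / (2 * (1 - \<eta>))"
proof -
  define M where "M = mat 1 - R"
  define V where "V = B - skew B"
  have V: "transpose V = V"
    unfolding V_def by (rule symmetric_part)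
  have "M ** transpose M = M + transpose M"
    using R by (simp add: M_def transpose_diff matrix_sub_ldistrib matrix_sub_rdistrib
        orthogonal_matrix_def)
  then have "M \<bullet> (V ** M) = V \<bullet> (M + transpose M)"
    by (simp add: inner_commute[of M] inner_mult_right)
  also have "\<dots> = 2 * (M \<bullet> V)"
    using V inner_transpose[of V M] by (simp add: inner_add_right inner_commute)
  finally have MV: "M \<bullet> V = (M \<bullet> (V ** M)) / 2" by simp
  have "V - mat 1 = (1/2) *\<^sub>R ((B - mat 1) + transpose (B - mat 1))"
    by (simp add: V_def symmetric_part(1) transpose_diff vec_eq_iff field_simps)
  then have "norm (V - mat 1) \<le> norm (B - mat 1)"
    using norm_triangle_ineq[of "B - mat 1" "transpose (B - mat 1)"] by (simp add: norm_transpose)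
  then have "norm (V - mat 1) * norm M \<le> \<eta> * norm M"
    by (rule mult_right_mono[OF order_trans[OF _ near(1)] norm_ge_zero])
  then have "norm ((V - mat 1) ** M) \<le> \<eta> * norm M"
    using norm_matrix_mult_le[of "V - mat 1" M] by linarith
  then have "norm M * norm ((V - mat 1) ** M) \<le> norm M * (\<eta> * norm M)"
    by (rule mult_left_mono) simp
  then have "- (M \<bullet> ((V - mat 1) ** M)) \<le> norm M * (\<eta> * norm M)"
    using Cauchy_Schwarz_ineq2[of M "(V - mat 1) ** M"] by linarith
  then have MVM: "(1 - \<eta>) * (norm M)\<^sup>2 \<le> M \<bullet> (V ** M)"
    by (simp add: matrix_sub_rdistrib inner_diff_right power2_norm_eq_inner algebra_simps
        flip: power2_eq_square)
  have "- (M \<bullet> skew B) \<le> norm M * norm (skew B)"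
    using Cauchy_Schwarz_ineq2[of M "skew B"] by linarith
  then have "R \<bullet> B \<le> trace B - (1 - \<eta>) * (norm M)\<^sup>2 / 2 + norm M * norm (skew B)"
    using MV MVM by (simp add: M_def V_def inner_diff_left inner_diff_right inner_mat_1)
  also have "\<dots> \<le> trace B + (norm (skew B))\<^sup>2 / (2 * (1 - \<eta>))"
  proof -
    \<comment> \<open>Completing the square in \<open>norm M\<close> removes the dependence on
      \<open>R\<close>.\<close>
    have "0 \<le> (norm (skew B) - (1 - \<eta>) * norm M)\<^sup>2 / (2 * (1 - \<eta>))"
      using near by simp
    also have "\<dots> = (norm (skew B))\<^sup>2 / (2 * (1 - \<eta>)) - norm M * norm (skew B)
        + (1 - \<eta>) * (norm M)\<^sup>2 / 2"
      using near by (simp add: power2_eq_square field_simps)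
    finally show ?thesis by linarith
  qed
  finally show ?thesis .
qed

subsection \<open>The null Lagrangian\<close>

definition null_lagrangian :: "real^'n^'n \<Rightarrow> real" where
  "null_lagrangian F = ((trace F)\<^sup>2 - trace (F ** F)) / 2"

text \<open>A quadratic form equals its second-order expansion; the matrix paired with
  \<open>F - A\<close> is the gradient at \<open>A\<close>.\<close>

lemma null_lagrangian_diff:
  "null_lagrangian F - null_lagrangian A =
     (trace A *\<^sub>R mat 1 - transpose A) \<bullet> (F - A) + null_lagrangian (F - A)"
proof -
  have "transpose F \<bullet> A = transpose A \<bullet> F"
    using inner_transpose[of F A] by (simp add: inner_commute)
  moreover have N: "null_lagrangian B = ((mat 1 \<bullet> B)\<^sup>2 - transpose B \<bullet> B) / 2" for B :: "real^'n^'n"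
    by (simp add: null_lagrangian_def inner_mat_1 inner_matrix_trace)
  ultimately show ?thesis
    unfolding N inner_mat_1[symmetric]
    by (simp add: transpose_diff inner_diff_left inner_diff_right power2_eq_square field_simps)
qed

text \<open>For \<open>R = mat 1\<close> the first two terms are at least \<open>b\<close> times a
  quarter of the squared symmetric part plus three quarters of the squared skew part, and
  \<open>3/4\<close> exceeds \<open>11/20\<close>. The slack absorbs the error from an
  \<open>R\<close> that is only close to the identity.\<close>

lemma quadratic_form_nonneg:
  fixes H R :: "real^'n^'n"
  assumes R: "norm (R - mat 1) \<le> 1/50" and b: "0 \<le> b"
  shows "0 \<le> b/2 * (norm H)\<^sup>2 + b/2 * null_lagrangian H
              - 11/20 * b * (norm (skew (transpose R ** H)))\<^sup>2"
proof -
  define h s a where "h = norm H" and "s = norm (H - skew H)" and "a = norm (skew H)"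
  have h: "h\<^sup>2 = s\<^sup>2 + a\<^sup>2"
    unfolding h_def s_def a_def by (rule norm_sq_skew)
  have "trace (H ** H) = s\<^sup>2 - a\<^sup>2"
    unfolding s_def a_def
    by (simp add: inner_matrix_trace flip: transpose_inner_skew)
  then have N: "(a\<^sup>2 - s\<^sup>2) / 2 \<le> null_lagrangian H"
    by (simp add: null_lagrangian_def)
  have "norm ((transpose R - mat 1) ** H) \<le> 1/50 * h"
    using R norm_transpose[of "R - mat 1"] unfolding h_def
    by (intro order_trans[OF norm_matrix_mult_le] mult_right_mono) (auto simp: transpose_diff)
  moreover have "norm (skew (transpose R ** H)) = norm (skew ((transpose R - mat 1) ** H) + skew H)"
    by (simp add: skew_diff matrix_sub_rdistrib)
  ultimately have k: "norm (skew (transpose R ** H)) \<le> 1/50 * h + a"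
    using norm_triangle_ineq[of "skew ((transpose R - mat 1) ** H)" "skew H"]
      norm_skew_le[of "(transpose R - mat 1) ** H"]
    unfolding a_def by linarith
  have "a \<le> h" by (simp add: a_def h_def norm_skew_le)
  then have "a * h \<le> h\<^sup>2"
    by (simp add: power2_eq_square mult_right_mono h_def)
  moreover have "(1/50 * h + a)\<^sup>2 = a\<^sup>2 + 1/2500 * h\<^sup>2 + 1/25 * (a * h)"
    by (simp add: power2_eq_square algebra_simps)
  ultimately have "(1/50 * h + a)\<^sup>2 \<le> a\<^sup>2 + 1/20 * h\<^sup>2"
    using zero_le_power2[of h] by linarith
  moreover have "(norm (skew (transpose R ** H)))\<^sup>2 \<le> (1/50 * h + a)\<^sup>2"
    using k by (intro power_mono) auto
  ultimately have "(norm (skew (transpose R ** H)))\<^sup>2 \<le> a\<^sup>2 + 1/20 * h\<^sup>2"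
    by (rule order_trans[rotated])
  \<comment> \<open>With \<open>h^2 = s^2 + a^2\<close> the coefficients left over are
    \<open>1/4 - 11/400\<close> for \<open>s^2\<close> and \<open>3/4 - 11/20 - 11/400\<close> for
    \<open>a^2\<close>, both positive.\<close>
  then have "0 \<le> (norm H)\<^sup>2 / 2 + null_lagrangian H / 2
      - 11/20 * (norm (skew (transpose R ** H)))\<^sup>2"
    using N h zero_le_power2[of s] zero_le_power2[of a] unfolding h_def[symmetric] by argo
  from mult_left_mono[OF this b] show ?thesis
    by (simp add: algebra_simps)
qed

subsection \<open>Tangent inequality near the identity\<close>

lemma inner_diag_mat: "diag d \<bullet> (A :: real^'n^'n) = (\<Sum>i\<in>UNIV. d i * A $ i $ i)"
  by (simp add: inner_vec_def diag_nth if_distrib[of "\<lambda>x. x * _"] cong: if_cong)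

lemma norm_diag_le: "norm (diag d :: real^'n^'n) \<le> (\<Sum>i\<in>UNIV. \<bar>d i\<bar>)"
proof -
  have "(norm (diag d :: real^'n^'n))\<^sup>2 = (\<Sum>i\<in>UNIV. (d i)\<^sup>2)"
    unfolding power2_norm_eq_inner inner_diag_mat by (simp add: diag_nth power2_eq_square)
  then have "norm (diag d :: real^'n^'n) = L2_set d UNIV"
    by (simp add: L2_set_def real_sqrt_unique)
  then show ?thesis using L2_set_le_sum_abs by metis
qed

text \<open>The squared entries form a doubly stochastic matrix, the source of the averaging weights
  below.\<close>

lemma orthogonal_matrix_sum_squares:
  fixes P :: "real^'n^'n"
  assumes "orthogonal_matrix P"
  shows "(\<Sum>k\<in>UNIV. (P $ i $ k)\<^sup>2) = 1" "(\<Sum>k\<in>UNIV. (P $ k $ i)\<^sup>2) = 1"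
proof -
  have "(P ** transpose P) $ i $ i = 1" "(transpose P ** P) $ i $ i = 1"
    using assms by (simp_all add: orthogonal_matrix_def mat_def)
  then show "(\<Sum>k\<in>UNIV. (P $ i $ k)\<^sup>2) = 1" "(\<Sum>k\<in>UNIV. (P $ k $ i)\<^sup>2) = 1"
    by (simp_all add: matrix_matrix_mult_def transpose_def power2_eq_square)
qed

lemma orthogonal_matrix_nth_le_1:
  "orthogonal_matrix (P :: real^'n^'n) \<Longrightarrow> P $ i $ j \<le> 1"
  using member_le_sum[of j UNIV "\<lambda>k. (P $ i $ k)\<^sup>2"] orthogonal_matrix_sum_squares(1)[of P i]
  by (simp add: power_le_one_iff abs_square_le_1 abs_le_iff)

text \<open>\<open>P ** transpose Q\<close> is the orthogonal factor of the polar decomposition;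
  pairing \<open>F\<close> with it yields the nuclear norm.\<close>

lemma svd_inner:
  assumes "is_svd F P l Q"
  shows "(P ** transpose Q) \<bullet> F = (\<Sum>i\<in>UNIV. l i)" "(norm F)\<^sup>2 = (\<Sum>i\<in>UNIV. (l i)\<^sup>2)"
proof -
  have P: "orthogonal_matrix P" and Q: "orthogonal_matrix (transpose Q)"
    and F: "F = P ** diag l ** transpose Q"
    using assms by (auto simp: is_svd_def)
  have "(P ** transpose Q) \<bullet> F = P \<bullet> (P ** diag l)"
    using Q by (simp add: F inner_orthogonal_mult)
  also have "\<dots> = mat 1 \<bullet> (diag l :: real^_^_)"
    using inner_orthogonal_mult(1)[OF P, of "mat 1"] by simp
  finally show "(P ** transpose Q) \<bullet> F = (\<Sum>i\<in>UNIV. l i)"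
    by (simp add: inner_mat_1 trace_def diag_nth)
  have "norm F = norm (diag l :: real^_^_)"
    using P Q by (simp add: F norm_orthogonal_mult)
  then have "(norm F)\<^sup>2 = (norm (diag l :: real^_^_))\<^sup>2" by simp
  then show "(norm F)\<^sup>2 = (\<Sum>i\<in>UNIV. (l i)\<^sup>2)"
    unfolding power2_norm_eq_inner inner_diag_mat by (simp add: diag_nth power2_eq_square)
qed

text \<open>The polar factor minimizes the distance to the orthogonal group.\<close>

lemma svd_near_identity:
  assumes "is_svd A X d Y"
  shows "norm (A - X ** transpose Y) \<le> norm (A - mat 1)" "\<bar>d i - 1\<bar> \<le> norm (A - mat 1)"
proof -
  have X: "orthogonal_matrix X" and Y: "orthogonal_matrix Y" and d: "\<And>i. 0 \<le> d i"
    and A: "A = X ** diag d ** transpose Y"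
    using assms by (auto simp: is_svd_def)
  define Z where "Z = transpose X ** Y"
  have Z: "orthogonal_matrix Z"
    using X Y by (simp add: Z_def orthogonal_matrix_mul)
  let ?D = "diag d :: real^'a^'a"
  have "A - mat 1 = X ** (?D - Z) ** transpose Y"
    using X Y unfolding A Z_def matrix_sub_ldistrib matrix_sub_rdistrib
    by (metis matrix_mul_assoc matrix_mul_rid orthogonal_matrix_def)
  then have 1: "norm (A - mat 1) = norm (?D - Z)"
    using X Y by (simp add: norm_orthogonal_mult)
  have 2: "norm (A - X ** transpose Y) = norm (?D - mat 1)"
  proof -
    have "A - X ** transpose Y = X ** (?D - mat 1) ** transpose Y"
      by (simp add: A matrix_sub_ldistrib matrix_sub_rdistrib)
    then show ?thesis using X Y by (simp add: norm_orthogonal_mult)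
  qed
  \<comment> \<open>The diagonal entries of \<open>Z\<close> are at most 1 and \<open>d\<close> is
    nonnegative. As all orthogonal matrices have the same norm, a larger inner product with
    \<open>?D\<close> means a smaller distance to it.\<close>
  have "?D \<bullet> Z \<le> ?D \<bullet> mat 1"
    unfolding inner_diag_mat
    using d Z by (intro sum_mono) (simp add: mat_def mult_left_le orthogonal_matrix_nth_le_1)
  moreover have "(norm Z)\<^sup>2 = (norm (mat 1 :: real^'a^'a))\<^sup>2"
    using Z by (simp add: norm_orthogonal_matrix)
  ultimately have "(norm (?D - mat 1))\<^sup>2 \<le> (norm (?D - Z))\<^sup>2"
    by (simp add: power2_norm_eq_inner inner_diff_left inner_diff_right inner_commute)
  then have 3: "norm (?D - mat 1) \<le> norm (?D - Z)"
    by (rule power2_le_imp_le) simp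
  then show "norm (A - X ** transpose Y) \<le> norm (A - mat 1)"
    using 1 2 by simp
  have "\<bar>d i - 1\<bar> \<le> norm (?D - mat 1)"
    using abs_nth_le_norm[of "?D - mat 1" i i] by (simp add: diag_nth mat_def)
  then show "\<bar>d i - 1\<bar> \<le> norm (A - mat 1)"
    using 1 3 by simp
qed

text \<open>Each diagonal entry of \<open>transpose X ** F ** Y\<close> is at most an average of the
  \<open>l k\<close> with doubly stochastic weights. Nonnegative slopes allow replacing it by that
  average, the tangent inequality is averaged along rows, and the column sums then leave each
  \<open>g (l k)\<close> with weight 1.\<close>

lemma sum_tangent_le_sum_singular_values:
  fixes F X Y :: "real^'n^'n" and d s l :: "'n \<Rightarrow> real"
  assumes svd: "is_svd F P l Q" and X: "orthogonal_matrix X" and Y: "orthogonal_matrix Y"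
    and tangent: "\<And>i k. g (d i) + s i * (l k - d i) \<le> g (l k)"
    and s: "\<And>i. 0 \<le> s i"
  shows "(\<Sum>i\<in>UNIV. g (d i) + s i * ((transpose X ** F ** Y) $ i $ i - d i)) \<le> (\<Sum>k\<in>UNIV. g (l k))"
proof -
  have P: "orthogonal_matrix P" and Q: "orthogonal_matrix Q" and l: "\<And>i. 0 \<le> l i"
    and F: "F = P ** diag l ** transpose Q"
    using svd by (auto simp: is_svd_def)
  define P' where "P' = transpose X ** P"
  define Q' where "Q' = transpose Y ** Q"
  have P': "orthogonal_matrix P'" and Q': "orthogonal_matrix Q'"
    using P Q X Y by (simp_all add: P'_def Q'_def orthogonal_matrix_mul)
  \<comment> \<open>The diagonal entries involve the products of \<open>P' $ i $ k\<close> and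
    \<open>Q' $ i $ k\<close>; the arithmetic-geometric mean inequality bounds these by
    \<open>m\<close>, a mean of two doubly stochastic matrices.\<close>
  define m where "m = (\<lambda>i k. ((P' $ i $ k)\<^sup>2 + (Q' $ i $ k)\<^sup>2) / 2)"
  have m_nonneg: "0 \<le> m i k" for i k by (simp add: m_def)
  have m_row: "(\<Sum>k\<in>UNIV. m i k) = 1" and m_col: "(\<Sum>i\<in>UNIV. m i k) = 1" for i k
    using orthogonal_matrix_sum_squares[OF P'] orthogonal_matrix_sum_squares[OF Q']
    by (simp_all add: m_def sum.distrib flip: sum_divide_distrib)
  have "transpose X ** F ** Y = P' ** diag l ** transpose Q'"
    by (simp add: F P'_def Q'_def matrix_transpose_mul matrix_mul_assoc)
  then have "(transpose X ** F ** Y) $ i $ i = (\<Sum>k\<in>UNIV. P' $ i $ k * l k * Q' $ i $ k)" for i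
    by (simp add: matrix_matrix_mult_def[of "P' ** diag l"] mult_diag_nth transpose_def)
  moreover have "P' $ i $ k * l k * Q' $ i $ k \<le> m i k * l k" for i k
  proof -
    have "P' $ i $ k * Q' $ i $ k \<le> m i k"
      using sum_squares_bound[of "P' $ i $ k" "Q' $ i $ k"] by (simp add: m_def)
    from mult_right_mono[OF this l[of k]] show ?thesis by (simp add: mult_ac)
  qed
  ultimately have diag_le: "(transpose X ** F ** Y) $ i $ i \<le> (\<Sum>k\<in>UNIV. m i k * l k)" for i
    by (simp add: sum_mono)
  have "g (d i) + s i * ((transpose X ** F ** Y) $ i $ i - d i) \<le> (\<Sum>k\<in>UNIV. m i k * g (l k))" for i
  proof -
    have "g (d i) + s i * ((transpose X ** F ** Y) $ i $ i - d i)
        \<le> g (d i) + s i * ((\<Sum>k\<in>UNIV. m i k * l k) - d i)"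
      using mult_left_mono[OF diag_le s] by (simp add: right_diff_distrib)
    also have "\<dots> = (\<Sum>k\<in>UNIV. m i k * (g (d i) + s i * (l k - d i)))"
    proof -
      have "(\<Sum>k\<in>UNIV. m i k * (g (d i) + s i * (l k - d i))) =
          (\<Sum>k\<in>UNIV. m i k) * (g (d i) - s i * d i) + s i * (\<Sum>k\<in>UNIV. m i k * l k)"
        unfolding sum_distrib_left sum_distrib_right sum.distrib[symmetric]
        by (intro sum.cong) (simp_all add: algebra_simps)
      then show ?thesis
        unfolding m_row by (simp add: algebra_simps)
    qed
    also have "\<dots> \<le> (\<Sum>k\<in>UNIV. m i k * g (l k))"
      by (intro sum_mono mult_left_mono tangent m_nonneg)
    finally show ?thesis .
  qed
  then have "(\<Sum>i\<in>UNIV. g (d i) + s i * ((transpose X ** F ** Y) $ i $ i - d i))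
      \<le> (\<Sum>i\<in>UNIV. \<Sum>k\<in>UNIV. m i k * g (l k))"
    by (rule sum_mono)
  also have "\<dots> = (\<Sum>k\<in>UNIV. (\<Sum>i\<in>UNIV. m i k) * g (l k))"
    by (subst sum.swap) (simp add: sum_distrib_right)
  also have "\<dots> = (\<Sum>k\<in>UNIV. g (l k))" by (simp add: m_col)
  finally show ?thesis .
qed

text \<open>It is applied with \<open>b = w'' 1 / 2\<close>; then \<open>g'\<close> is close to \<open>c - b = b/20\<close> near 1.\<close>

lemma tangent_inequality:
  fixes g g' w :: "real \<Rightarrow> real" and A :: "real^'n^'n" and b c r m K :: real
  assumes w: "\<And>x. w x = g x + b/2 * x\<^sup>2 - c * x"
    and b: "0 < b" "0 \<le> c" "c \<le> 21/20 * b" and r: "0 < r" "r \<le> 1/100"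
    and tangent: "\<And>x y. \<lbrakk>\<bar>x - 1\<bar> \<le> r; \<bar>y - 1\<bar> \<le> r\<rbrakk> \<Longrightarrow> g x + g' x * (y - x) \<le> g y"
    and g': "\<And>x. \<bar>x - 1\<bar> \<le> r \<Longrightarrow> 0 \<le> g' x \<and> g' x \<le> K"
    and A: "norm (A - mat 1) \<le> r" "det A \<noteq> 0"
    and m: "m = norm (mat 1 :: real^'n^'n)"
  obtains T where
    "norm T \<le> CARD('n) * K + b * (m + 1) + c * m + b/2 * (m * (m + 1) * m + (m + 1))"
    "\<And>F. \<lbrakk>norm (F - mat 1) \<le> r; det F \<noteq> 0\<rbrakk> \<Longrightarrow>
       W_VL w A + b/2 * null_lagrangian A + T \<bullet> (F - A) \<le> W_VL w F + b/2 * null_lagrangian F"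
proof -
  obtain X d Y where svdA: "is_svd A X d Y"
    using svd_exists A by blast
  then have X: "orthogonal_matrix X" and Y: "orthogonal_matrix Y"
    and A_eq: "A = X ** diag d ** transpose Y"
    by (auto simp: is_svd_def)
  define R where "R = X ** transpose Y"
  have R: "orthogonal_matrix R"
    using X Y by (simp add: R_def orthogonal_matrix_mul)
  have AR: "norm (A - R) \<le> r" and d: "\<bar>d i - 1\<bar> \<le> r" for i
    using svd_near_identity[OF svdA] A by (auto simp: R_def intro: order_trans)
  have R1: "norm (R - mat 1) \<le> 2 * r"
    using norm_triangle_ineq[of "R - A" "A - mat 1"] AR A by (simp add: norm_minus_commute)
  define s where "s = (\<lambda>i. g' (d i))"
  have s: "0 \<le> s i" "s i \<le> K" for i
    using g' d by (auto simp: s_def)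
  define D where "D = trace A *\<^sub>R mat 1 - transpose A"
  \<comment> \<open>The four terms linearize at \<open>A\<close>, in this order, the sum of
    \<open>g\<close> over the singular values, \<open>b/2\<close> times the squared norm,
    \<open>- c\<close> times the nuclear norm, and \<open>b/2\<close> times the null
    Lagrangian.\<close>
  define T where "T = X ** diag s ** transpose Y + b *\<^sub>R A - c *\<^sub>R R + (b/2) *\<^sub>R D"
  have nA: "norm A \<le> m + 1"
    using norm_triangle_ineq[of "A - mat 1" "mat 1"] A r by (simp add: m)
  \<comment> \<open>The bound is uniform in \<open>A\<close>; finiteness of the later supremum at
    arbitrary minor vectors rests on this.\<close>
  have "norm T \<le> CARD('n) * K + b * (m + 1) + c * m + b/2 * (m * (m + 1) * m + (m + 1))"
  proof -
    have "norm (X ** diag s ** transpose Y) \<le> CARD('n) * K"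
    proof -
      have "norm (X ** diag s ** transpose Y) \<le> (\<Sum>i\<in>UNIV. \<bar>s i\<bar>)"
        using X Y norm_diag_le by (simp add: norm_orthogonal_mult)
      also have "\<dots> \<le> CARD('n) * K"
        using s by (intro sum_bounded_above) simp
      finally show ?thesis .
    qed
    moreover have "norm (b *\<^sub>R A) \<le> b * (m + 1)"
      using nA b by simp
    moreover have "norm (c *\<^sub>R R) = c * m"
      using R b by (simp add: m norm_orthogonal_matrix)
    moreover have "norm D \<le> m * (m + 1) * m + (m + 1)"
    proof -
      have "\<bar>trace A\<bar> \<le> m * norm A"
        using Cauchy_Schwarz_ineq2[of "mat 1" A] by (simp add: inner_mat_1 m)
      also have "\<dots> \<le> m * (m + 1)"
        using nA by (intro mult_left_mono) (auto simp: m)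
      finally have "norm (trace A *\<^sub>R mat 1 :: real^'n^'n) \<le> m * (m + 1) * m"
        by (simp add: m mult_right_mono)
      then show ?thesis
        using norm_triangle_ineq4[of "trace A *\<^sub>R mat 1" "transpose A"] nA
        unfolding D_def norm_transpose by linarith
    qed
    then have "norm ((b/2) *\<^sub>R D) \<le> b/2 * (m * (m + 1) * m + (m + 1))"
      using b by simp
    ultimately show ?thesis
      unfolding T_def
      by (smt (verit) norm_triangle_ineq norm_triangle_ineq4)
  qed
  moreover have "W_VL w A + b/2 * null_lagrangian A + T \<bullet> (F - A)
      \<le> W_VL w F + b/2 * null_lagrangian F"
    if F: "norm (F - mat 1) \<le> r" "det F \<noteq> 0" for F
  proof -
    obtain P l Q where svdF: "is_svd F P l Q"
      using svd_exists F by blast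
    then have P: "orthogonal_matrix P" and Q: "orthogonal_matrix Q"
      by (auto simp: is_svd_def)
    have l: "\<bar>l i - 1\<bar> \<le> r" for i
      using svd_near_identity(2)[OF svdF, of i] F by simp
    define H where "H = F - A"
    \<comment> \<open>The splitting of \<open>w\<close> summed over singular values: its quadratic
      term becomes the Frobenius norm and its linear term the nuclear norm, written through the
      polar factor.\<close>
    have W: "W_VL w B = (\<Sum>i\<in>UNIV. g (e i)) + b/2 * (norm B)\<^sup>2 - c * ((U ** transpose V) \<bullet> B)"
      if "is_svd B U e V" for B U V :: "real^'n^'n" and e
      using svd_inner[OF that]
      by (simp add: W_VL_svd[OF that] w sum.distrib sum_subtractf sum_distrib_left)
    have "(\<Sum>i\<in>UNIV. g (d i) + s i * ((transpose X ** F ** Y) $ i $ i - d i)) \<le> (\<Sum>k\<in>UNIV. g (l k))"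
      using tangent[OF d l] s by (intro sum_tangent_le_sum_singular_values[OF svdF X Y]) (auto simp: s_def)
    moreover have "(X ** diag s ** transpose Y) \<bullet> H =
        (\<Sum>i\<in>UNIV. s i * ((transpose X ** F ** Y) $ i $ i - d i))"
    proof -
      have "(X ** diag s ** transpose Y) \<bullet> H = diag s \<bullet> (transpose X ** H ** Y)"
        by (simp add: inner_mult_right[of "X ** diag s"] inner_mult_left[of X "diag s"] matrix_mul_assoc)
      moreover have "transpose X ** A ** Y = diag d"
        using X Y unfolding A_eq
        by (metis (no_types) matrix_mul_assoc matrix_mul_lid matrix_mul_rid orthogonal_matrix_def)
      ultimately show ?thesis
        by (simp add: inner_diag_mat H_def matrix_sub_ldistrib matrix_sub_rdistrib diag_nth)
    qed
    ultimately have g_part: "(\<Sum>i\<in>UNIV. g (d i)) + (X ** diag s ** transpose Y) \<bullet> H \<le> (\<Sum>k\<in>UNIV. g (l k))"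
      by (simp add: sum.distrib)
    define q where "q = (norm (skew (transpose R ** H)))\<^sup>2"
    \<comment> \<open>Multiplying by \<open>transpose R\<close> moves the polar factor of
      \<open>A\<close> to the identity, and \<open>transpose R ** F\<close> is within
      \<open>3 * r\<close> of it, so the trace estimate applies with
      \<open>\<eta> = 3 * r\<close>.\<close>
    have nuclear: "(P ** transpose Q) \<bullet> F \<le> R \<bullet> F + q / (2 * (1 - 3 * r))"
    proof -
      have "(P ** transpose Q) \<bullet> F = (transpose R ** (P ** transpose Q)) \<bullet> (transpose R ** F)"
        using R by (simp add: inner_orthogonal_mult)
      also have "\<dots> \<le> trace (transpose R ** F) + (norm (skew (transpose R ** F)))\<^sup>2 / (2 * (1 - 3 * r))"
      proof (rule inner_orthogonal_le_trace)
        show "orthogonal_matrix (transpose R ** (P ** transpose Q))"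
          using R P Q by (simp add: orthogonal_matrix_mul)
        have "norm (transpose R ** F - mat 1) = norm (transpose R ** (F - R))"
          using R by (simp add: matrix_sub_ldistrib orthogonal_matrix_def)
        also have "\<dots> = norm (F - R)"
          using R by (simp add: norm_orthogonal_mult)
        also have "\<dots> \<le> 3 * r"
          using norm_triangle_ineq4[of "F - mat 1" "R - mat 1"] F R1 by simp
        finally show "norm (transpose R ** F - mat 1) \<le> 3 * r" .
      qed (use r in simp)
      also have "trace (transpose R ** F) = R \<bullet> F"
        by (simp add: inner_matrix_trace)
      \<comment> \<open>\<open>transpose R ** A\<close> is the symmetric stretch of the polar
        decomposition, so subtracting it does not change the skew part.\<close>
      also have "skew (transpose R ** F) = skew (transpose R ** H)"
      proof -
        have "transpose R ** A = Y ** (transpose X ** X) ** diag d ** transpose Y"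
          by (simp add: R_def A_eq matrix_transpose_mul matrix_mul_assoc)
        then have "transpose R ** A = Y ** diag d ** transpose Y"
          using X by (simp add: orthogonal_matrix_def)
        then have "skew (transpose R ** A) = 0"
          by (intro skew_symmetric) (simp add: matrix_transpose_mul matrix_mul_assoc)
        then show ?thesis by (simp add: H_def matrix_sub_ldistrib skew_diff)
      qed
      finally show ?thesis by (simp add: q_def)
    qed
    have "c * q / (2 * (1 - 3 * r)) \<le> 11/20 * b * q"
    proof -
      have "c / (2 * (1 - 3 * r)) \<le> 11/20 * b"
      proof -
        \<comment> \<open>Here \<open>1 - 3 * r \<ge> 97/100\<close> because
          \<open>r \<le> 1/100\<close>, and \<open>11/20 * 2 * 97/100 = 1067/1000\<close> exceeds
          \<open>21/20\<close>.\<close>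
        have "11/20 * b * (2 * (97/100)) \<le> 11/20 * b * (2 * (1 - 3 * r))"
          using b r by (intro mult_left_mono) auto
        then have "c \<le> 11/20 * b * (2 * (1 - 3 * r))" using b by linarith
        then show ?thesis using r by (simp add: pos_divide_le_eq)
      qed
      from mult_right_mono[OF this, of q] show ?thesis by (simp add: q_def)
    qed
    moreover have "0 \<le> b/2 * (norm H)\<^sup>2 + b/2 * null_lagrangian H - 11/20 * b * q"
      unfolding q_def using R1 r b by (intro quadratic_form_nonneg) auto
    ultimately have quad: "0 \<le> b/2 * (norm H)\<^sup>2 + b/2 * null_lagrangian H - c * q / (2 * (1 - 3 * r))"
      by linarith
    have nuclear': "c * ((P ** transpose Q) \<bullet> F) \<le> c * (R \<bullet> F) + c * q / (2 * (1 - 3 * r))"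
      using mult_left_mono[OF nuclear b(2)] by (simp add: distrib_left)
    have sq: "(norm F)\<^sup>2 = (norm A)\<^sup>2 + 2 * (A \<bullet> H) + (norm H)\<^sup>2"
      unfolding H_def power2_norm_eq_inner
      by (simp add: inner_diff_left inner_diff_right inner_commute algebra_simps)
    have N: "null_lagrangian F = null_lagrangian A + D \<bullet> H + null_lagrangian H"
      using null_lagrangian_diff[of F A] by (simp add: D_def H_def)
    have RF: "R \<bullet> F = R \<bullet> A + R \<bullet> H"
      by (simp add: H_def inner_diff_right)
    have TH: "T \<bullet> H = (X ** diag s ** transpose Y) \<bullet> H + b * (A \<bullet> H) - c * (R \<bullet> H) + b/2 * (D \<bullet> H)"
      by (simp add: T_def inner_add_left inner_diff_left)
    show ?thesis
      unfolding H_def[symmetric] W[OF svdA] W[OF svdF] TH N sq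
      using g_part quad nuclear' unfolding RF R_def[symmetric]
      by (simp add: algebra_simps)
  qed
  ultimately show ?thesis by (rule that)
qed

subsection \<open>Extension by suprema of affine functions of the minors\<close>

lemma convex_on_cSUP:
  fixes f :: "'a \<Rightarrow> 'b::real_vector \<Rightarrow> real"
  assumes "I \<noteq> {}" and conv: "\<And>i. i \<in> I \<Longrightarrow> convex_on S (f i)"
    and bdd: "\<And>x. x \<in> S \<Longrightarrow> bdd_above ((\<lambda>i. f i x) ` I)"
  shows "convex_on S (\<lambda>x. SUP i\<in>I. f i x)"
  unfolding convex_on_def
proof (intro conjI ballI allI impI)
  show "convex S"
    using assms by (auto simp: convex_on_def)
  fix x y and u v :: real
  assume xy: "x \<in> S" "y \<in> S" and uv: "0 \<le> u" "0 \<le> v" "u + v = 1"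
  show "(SUP i\<in>I. f i (u *\<^sub>R x + v *\<^sub>R y)) \<le> u * (SUP i\<in>I. f i x) + v * (SUP i\<in>I. f i y)"
  proof (rule cSUP_least[OF \<open>I \<noteq> {}\<close>])
    fix i assume i: "i \<in> I"
    then have "f i (u *\<^sub>R x + v *\<^sub>R y) \<le> u * f i x + v * f i y"
      using conv xy uv by (auto simp: convex_on_def)
    also have "\<dots> \<le> u * (SUP i\<in>I. f i x) + v * (SUP i\<in>I. f i y)"
      using i xy uv bdd by (intro add_mono mult_left_mono cSUP_upper) auto
    finally show "f i (u *\<^sub>R x + v *\<^sub>R y) \<le> u * (SUP i\<in>I. f i x) + v * (SUP i\<in>I. f i y)" .
  qed
qed

text \<open>The extension is the supremum of the \<open>f A\<close> as functions of the minor
  vector. On \<open>U\<close> all of them lie below \<open>W\<close> and \<open>f F\<close> touches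
  it at \<open>F\<close>. Boundedness is demanded at every \<open>v\<close>, since the supremum must
  be finite also at vectors that are not the minors of a matrix.\<close>

lemma polyconvex_extension:
  fixes U :: "(real^'n::{finite,linorder}^'n::{finite,linorder}) set"
  assumes "U \<noteq> {}"
    and conv: "\<And>A. A \<in> U \<Longrightarrow> convex_on UNIV (f A)"
    and bdd: "\<And>v. bdd_above ((\<lambda>A. f A v) ` U)"
    and le: "\<And>A F. \<lbrakk>A \<in> U; F \<in> U\<rbrakk> \<Longrightarrow> f A (minors F) \<le> W F"
    and eq: "\<And>F. F \<in> U \<Longrightarrow> f F (minors F) = W F"
  shows "\<exists>V. polyconvex V \<and> (\<forall>F\<in>U. V F = W F)"
proof (intro exI conjI ballI)
  let ?P = "\<lambda>v. SUP A\<in>U. f A v"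
  have "convex_on UNIV ?P"
    using assms by (intro convex_on_cSUP) auto
  moreover have "convex {v :: real^('n minor_index). 0 < v $ full_index}"
    by (auto simp: convex_alt intro: add_nonneg_pos add_pos_nonneg)
      (metis add_nonneg_pos add_pos_nonneg diff_ge_0_iff_ge less_eq_real_def mult_nonneg_nonneg
        mult_pos_pos add.commute diff_add_cancel less_numeral_extra(1))
  ultimately have "convex_on {v. 0 < v $ full_index} ?P"
    using convex_on_subset by blast
  then show "polyconvex (\<lambda>F. ?P (minors F))"
    unfolding polyconvex_def by blast
  fix F assume F: "F \<in> U"
  show "?P (minors F) = W F"
  proof (rule antisym)
    show "?P (minors F) \<le> W F"
      using F le \<open>U \<noteq> {}\<close> by (intro cSUP_least) auto
    show "W F \<le> ?P (minors F)"
      using F eq bdd by (intro cSUP_upper2[of _ _ F]) auto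
  qed
qed

section \<open>Minors of orders 1 and 2 as linear coordinates\<close>

lemma minor_singleton: "minor F {i} {j} = F $ i $ j"
  by (simp add: minor_def lessThan_Suc)

lemma minor_doubleton:
  fixes F :: "real^'n::{finite,linorder}^'n::{finite,linorder}"
  assumes "i \<noteq> j"
  shows "minor F {i, j} {i, j} = F $ i $ i * F $ j $ j - F $ i $ j * F $ j $ i"
proof -
  have less: "minor F {i, j} {i, j} = F $ i $ i * F $ j $ j - F $ i $ j * F $ j $ i"
    if "i < j" for i j :: 'n
  proof -
    have list: "sorted_list_of_set {i, j} = [i, j]"
      using that by (auto simp: sorted_list_of_set_insert_remove)
    have card: "card {i, j} = 2" using that by simp
    have two: "{..<2 :: nat} = {0, 1}" by auto
    have perms: "{p. p permutes {0, 1 :: nat}} = {id, Transposition.transpose 0 1}"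
      by (auto simp: permutes_doubleton_iff)
    have neq: "id \<noteq> Transposition.transpose 0 (1 :: nat)"
      by (metis id_apply transpose_apply_first zero_neq_one)
    show ?thesis
      unfolding minor_def card list two perms using neq by (simp add: sign_swap_id)
  qed
  show ?thesis
  proof (cases "i < j")
    case True
    then show ?thesis by (rule less)
  next
    case False
    then have "j < i" using assms by simp
    from less[OF this] show ?thesis by (simp add: insert_commute mult.commute)
  qed
qed

lemma minors_nth: "I \<noteq> {} \<Longrightarrow> card I = card J \<Longrightarrow> minors F $ Abs_minor_index (I, J) = minor F I J"
  by (simp add: minors_def Abs_minor_index_inverse)

text \<open>A linear left inverse of \<open>minors\<close>.\<close>

definition minors_matrix :: "real^('n::finite minor_index) \<Rightarrow> real^'n^'n" where
  "minors_matrix v = (\<chi> i j. v $ Abs_minor_index ({i}, {j}))"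

text \<open>The null Lagrangian as a linear functional of the principal minors of order 2; the
  double sum meets each pair twice, hence the division by 2.\<close>

definition minors_lagrangian :: "real^('n::finite minor_index) \<Rightarrow> real" where
  "minors_lagrangian v = (\<Sum>i\<in>UNIV. \<Sum>j\<in>UNIV - {i}. v $ Abs_minor_index ({i, j}, {i, j})) / 2"

lemma linear_minors_matrix: "linear minors_matrix"
  by (intro linearI) (simp_all add: minors_matrix_def vec_eq_iff)

lemma linear_minors_lagrangian: "linear minors_lagrangian"
  by (intro linearI) (simp_all add: minors_lagrangian_def sum.distrib add_divide_distrib sum_distrib_left)

lemma minors_matrix_minors: "minors_matrix (minors F) = F"
  by (simp add: minors_matrix_def vec_eq_iff minors_nth minor_singleton)

lemma minors_lagrangian_minors: "minors_lagrangian (minors F) = null_lagrangian F"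
proof -
  have "(\<Sum>j\<in>UNIV - {i}. minors F $ Abs_minor_index ({i, j}, {i, j})) =
      (\<Sum>j\<in>UNIV. F $ i $ i * F $ j $ j - F $ i $ j * F $ j $ i)" for i
  proof -
    have "(\<Sum>j\<in>UNIV - {i}. minors F $ Abs_minor_index ({i, j}, {i, j})) =
        (\<Sum>j\<in>UNIV - {i}. F $ i $ i * F $ j $ j - F $ i $ j * F $ j $ i)"
      by (intro sum.cong refl, subst minors_nth) (auto simp: minor_doubleton)
    \<comment> \<open>The added term \<open>j = i\<close> vanishes.\<close>
    also have "\<dots> = (\<Sum>j\<in>UNIV. F $ i $ i * F $ j $ j - F $ i $ j * F $ j $ i)"
      by (intro sum.mono_neutral_left) auto
    finally show ?thesis .
  qed
  then show ?thesis
    by (simp add: minors_lagrangian_def null_lagrangian_def trace_def matrix_matrix_mult_def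
        power2_eq_square sum_product sum_subtractf)
qed

lemma convex_on_const_add_linear:
  assumes "linear L"
  shows "convex_on UNIV (\<lambda>v. k + L v :: real)"
proof -
  interpret linear L by fact
  show ?thesis
    by (auto simp: convex_on_def add scale algebra_simps simp flip: distrib_right)
qed

text \<open>Taking only half of \<open>w'' 1\<close> for the quadratic term keeps
  \<open>w'' - b\<close>, the second derivative of \<open>g\<close>, positive near 1 by continuity.
  The coefficient \<open>21/20 * b\<close> gives \<open>g' 1 = b/20\<close>: slightly more than
  \<open>b\<close>, so that \<open>g\<close> increases as the averaging requires, yet small enough
  for the estimate of the concave term.\<close>

lemma convexity_constants:
  fixes w w' w'' :: "real \<Rightarrow> real"
  assumes w: "\<And>x. x > 0 \<Longrightarrow> (w has_real_derivative w' x) (at x)"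
    and w': "\<And>x. x > 0 \<Longrightarrow> (w' has_real_derivative w'' x) (at x)"
    and w'': "continuous_on {0<..} w''"
    and "w' 1 = 0" "w'' 1 > 0"
  defines "b \<equiv> w'' 1 / 2"
  defines "g \<equiv> \<lambda>x. w x - b/2 * x\<^sup>2 + 21/20 * b * x"
    and "g' \<equiv> \<lambda>x. w' x - b * x + 21/20 * b"
  obtains r where "0 < r" "r \<le> 1/100"
    "\<And>x y. \<lbrakk>\<bar>x - 1\<bar> \<le> r; \<bar>y - 1\<bar> \<le> r\<rbrakk> \<Longrightarrow> g x + g' x * (y - x) \<le> g y"
    "\<And>x. \<bar>x - 1\<bar> \<le> r \<Longrightarrow> 0 \<le> g' x \<and> g' x \<le> b/10"
proof -
  have b: "0 < b" using assms by (simp add: b_def)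
  have "isCont w'' 1"
    using w'' by (simp add: continuous_on_eq_continuous_at)
  then have "\<forall>\<^sub>F x in nhds 1. b < w'' x"
    using assms unfolding continuous_at b_def
    by (intro order_tendstoD(1)) (auto simp: tendsto_nhds_iff)
  moreover have "isCont w' 1"
    using w'[of 1] DERIV_isCont by auto
  then have lim: "(g' \<longlongrightarrow> b/20) (nhds 1)"
    using \<open>w' 1 = 0\<close> unfolding g'_def continuous_at tendsto_nhds_iff[symmetric]
    by (auto intro!: tendsto_eq_intros simp: tendsto_nhds_iff)
  have "\<forall>\<^sub>F x in nhds 1. g' x < b/10" "\<forall>\<^sub>F x in nhds 1. 0 < g' x"
    by (rule order_tendstoD[OF lim]; use b in simp)+
  ultimately have "\<forall>\<^sub>F x in nhds 1. b < w'' x \<and> g' x < b/10 \<and> 0 < g' x"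
    by eventually_elim auto
  then obtain e where e: "0 < e"
      "\<And>x. \<bar>x - 1\<bar> < e \<Longrightarrow> b < w'' x \<and> g' x < b/10 \<and> 0 < g' x"
    unfolding eventually_nhds_metric by (auto simp: dist_real_def)
  define r where "r = min (1/100) (e/2)"
  have r: "0 < r" "r \<le> 1/100" "r < e" using e by (auto simp: r_def)
  have "g x + g' x * (y - x) \<le> g y" if "\<bar>x - 1\<bar> \<le> r" "\<bar>y - 1\<bar> \<le> r" for x y
  proof -
    let ?C = "{1 - r..1 + r}"
    have C: "x > 0 \<and> \<bar>x - 1\<bar> < e" if "x \<in> ?C" for x using r that by (auto simp: abs_le_iff abs_less_iff)
    have "g' x * (y - x) \<le> g y - g x"
    proof (rule f''_imp_f'[of ?C g g' "\<lambda>x. w'' x - b"])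
      fix x assume "x \<in> ?C"
      from C[OF this] have x: "x > 0" "b < w'' x" using e by auto
      show "(g has_real_derivative g' x) (at x)"
        unfolding g_def g'_def using x by (auto intro!: derivative_eq_intros w)
      show "(g' has_real_derivative w'' x - b) (at x)"
        unfolding g'_def using x by (auto intro!: derivative_eq_intros w')
      show "w'' x - b \<ge> 0" using x by simp
    qed (use that in auto)
    then show ?thesis by simp
  qed
  moreover have "0 \<le> g' x \<and> g' x \<le> b/10" if "\<bar>x - 1\<bar> \<le> r" for x
    using e(2)[of x] that r by auto
  ultimately show ?thesis using that r by blast
qed

theorem proposition4p1:
  fixes w w' w'' :: "real \<Rightarrow> real"
  assumes "\<And>x. x > 0 \<Longrightarrow> (w has_real_derivative w' x) (at x)"
    and "\<And>x. x > 0 \<Longrightarrow> (w' has_real_derivative w'' x) (at x)"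
    and "continuous_on {0<..} w''"
    and "w' 1 = 0"
    and "w'' 1 > 0"
  shows "\<exists>(U :: (real^'n::{finite,linorder}^'n::{finite,linorder}) set) W.
           open U \<and> mat 1 \<in> U \<and> U \<subseteq> GL_plus \<and>
           polyconvex W \<and> (\<forall>F\<in>U. W F = W_VL w F)"
proof -
  \<comment> \<open>The small parameter in front of the null Lagrangian is
    \<open>b/2\<close>.\<close>
  define b where "b = w'' 1 / 2"
  define c where "c = 21/20 * b"
  define g where "g = (\<lambda>x. w x - b/2 * x\<^sup>2 + c * x)"
  define g' where "g' = (\<lambda>x. w' x - b * x + c)"
  have b: "0 < b" using assms by (simp add: b_def)
  obtain r where r: "0 < r" "r \<le> 1/100"
    and tangent: "\<And>x y. \<lbrakk>\<bar>x - 1\<bar> \<le> r; \<bar>y - 1\<bar> \<le> r\<rbrakk> \<Longrightarrow> g x + g' x * (y - x) \<le> g y"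
    and g': "\<And>x. \<bar>x - 1\<bar> \<le> r \<Longrightarrow> 0 \<le> g' x \<and> g' x \<le> b/10"
    using convexity_constants[OF assms] unfolding g_def g'_def c_def b_def by metis
  define U :: "(real^'n::{finite,linorder}^'n::{finite,linorder}) set" where "U = ball (mat 1) r \<inter> GL_plus"
  have U: "norm (F - mat 1) \<le> r" "det F \<noteq> 0" if "F \<in> U" for F
    using that by (auto simp: U_def GL_plus_def dist_norm norm_minus_commute)
  have "open U"
    unfolding U_def GL_plus_def det_def
    by (intro open_Int open_ball open_Collect_less continuous_intros)
  have id: "mat 1 \<in> U"
    using r by (simp add: U_def GL_plus_def)
  define G where "G F = W_VL w F + b/2 * null_lagrangian F" for F :: "real^'n::{finite,linorder}^'n::{finite,linorder}"
  define m where "m = norm (mat 1 :: real^'n::{finite,linorder}^'n::{finite,linorder})"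
  have "\<exists>C. \<forall>A\<in>U. \<exists>T. norm T \<le> C \<and> (\<forall>F\<in>U. G A + T \<bullet> (F - A) \<le> G F)"
  proof (rule exI, rule ballI)
    fix A assume A: "A \<in> U"
    show "\<exists>T. norm T \<le> CARD('n) * (b/10) + b * (m + 1) + c * m + b/2 * (m * (m + 1) * m + (m + 1)) \<and>
         (\<forall>F\<in>U. G A + T \<bullet> (F - A) \<le> G F)"
      by (rule tangent_inequality[of w g b c r g' "b/10" A, OF _ _ _ _ _ _ tangent g' _ _ m_def])
        (use A U b r in \<open>auto simp: g_def c_def G_def\<close>)
  qed
  then obtain C T where T: "\<And>A. A \<in> U \<Longrightarrow> norm (T A) \<le> C"
    and G: "\<And>A F. \<lbrakk>A \<in> U; F \<in> U\<rbrakk> \<Longrightarrow> G A + T A \<bullet> (F - A) \<le> G F"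
    by metis
  \<comment> \<open>The affine minorant of \<open>G\<close> at \<open>A\<close>, read through the
    minors of order 1, minus \<open>b/2\<close> times the null Lagrangian, read through those of
    order 2. The result is affine in \<open>v\<close>.\<close>
  define f where "f A v = (G A - T A \<bullet> A) + (T A \<bullet> minors_matrix v - b/2 * minors_lagrangian v)"
    for A v
  have "\<exists>V. polyconvex V \<and> (\<forall>F\<in>U. V F = W_VL w F)"
  proof (rule polyconvex_extension[where f = f])
    show "U \<noteq> {}" using id by blast
    show "convex_on UNIV (f A)" for A
      unfolding f_def
      by (intro convex_on_const_add_linear linearI)
        (simp_all add: linear_add[OF linear_minors_matrix] linear_add[OF linear_minors_lagrangian]
          linear_scale[OF linear_minors_matrix] linear_scale[OF linear_minors_lagrangian]
          inner_add_right algebra_simps)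
    \<comment> \<open>Evaluated at the identity, the minorant of \<open>G\<close> at
      \<open>A\<close> is at most \<open>G (mat 1)\<close>. The distance from there to
      \<open>minors_matrix v\<close> costs at most the uniform slope bound \<open>C\<close> times
      that distance.\<close>
    show "bdd_above ((\<lambda>A. f A v) ` U)" for v
    proof (rule bdd_aboveI2)
      fix A assume A: "A \<in> U"
      have "f A v = (G A + T A \<bullet> (mat 1 - A)) + T A \<bullet> (minors_matrix v - mat 1) - b/2 * minors_lagrangian v"
        by (simp add: f_def inner_diff_right)
      also have "\<dots> \<le> G (mat 1) + C * norm (minors_matrix v - mat 1) - b/2 * minors_lagrangian v"
      proof -
        have "T A \<bullet> (minors_matrix v - mat 1) \<le> norm (T A) * norm (minors_matrix v - mat 1)"
          by (rule norm_cauchy_schwarz)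
        also have "\<dots> \<le> C * norm (minors_matrix v - mat 1)"
          using T[OF A] by (rule mult_right_mono) simp
        finally show ?thesis using G[OF A id] by linarith
      qed
      finally show "f A v \<le> G (mat 1) + C * norm (minors_matrix v - mat 1) - b/2 * minors_lagrangian v" .
    qed
    show "f A (minors F) \<le> W_VL w F" if "A \<in> U" "F \<in> U" for A F
      using G[OF that]
      by (simp add: f_def G_def minors_matrix_minors minors_lagrangian_minors inner_diff_right)
    show "f F (minors F) = W_VL w F" if "F \<in> U" for F
      by (simp add: f_def G_def minors_matrix_minors minors_lagrangian_minors)
  qed
  moreover have "U \<subseteq> GL_plus" by (simp add: U_def)
  ultimately show ?thesis
    using \<open>open U\<close> id by blast
qed

end
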